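(* Let $\Omega$ be a semigroup and let $(\mathscr{A},\{\prec_\omega,\succ_\omega\mid\omega\in\Omega\},\alpha)$ be a Hom-rhizaform family algebra. For $\lambda,\omega\in\Omega$ define a bilinear operation on $\mathscr{A}$ by $$x\ast_{\lambda,\omega}y:=x\prec_\omega y+x\succ_\lambda y,\qquad x,y\in\mathscr{A}.$$ Then $\mathscr{A}$ with the family $(\ast_{\lambda,\omega})_{\lambda,\omega\in\Omega}$ and the map $\alpha$ is a Hom-anti-associative family algebra.
   Context: All vector spaces are over a fixed field; the product of $\lambda,\omega$ in the semigroup $\Omega$ is written $\lambda\omega$ (not assumed commutative). A Hom-rhizaform family algebra $(\mathscr{A},\{\prec_\omega,\succ_\omega\mid\omega\in\Omega\},\alpha)$ is a vector space $\mathscr{A}$ with bilinear operations $\prec_\omega,\succ_\omega$ ($\omega\in\Omega$) and a linear map $\alpha:\mathscr{A}\to\mathscr{A}$ such that for all $x,y,z\in\mathscr{A}$, $\lambda,\omega\in\Omega$: $\alpha(x\prec_\omega y)=\alpha(x)\prec_\omega\alpha(y)$, $\alpha(x\succ_\omega y)=\alpha(x)\succ_\omega\alpha(y)$, and $$(x\prec_\lambda y)\prec_\omega\alpha(z)=-\alpha(x)\prec_{\lambda\omega}(y\prec_\omega z+y\succ_\lambda z),$$ $$(x\succ_\lambda y)\prec_\omega\alpha(z)=-\alpha(x)\succ_\lambda(y\prec_\omega z),$$ $$(x\prec_\omega y+x\succ_\lambda y)\succ_{\lambda\omega}\alpha(z)=-\alpha(x)\succ_\lambda(y\succ_\omega z).$$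 A Hom-anti-associative family algebra is a vector space $\mathscr{A}$ with bilinear maps $\ast_{\lambda,\omega}:\mathscr{A}\times\mathscr{A}\to\mathscr{A}$ ($\lambda,\omega\in\Omega$) and a linear map $\alpha:\mathscr{A}\to\mathscr{A}$ such that $$(x\ast_{\lambda,\omega}y)\ast_{\lambda\omega,\gamma}\alpha(z)=-\alpha(x)\ast_{\lambda,\omega\gamma}(y\ast_{\omega,\gamma}z)$$ for all $x,y,z\in\mathscr{A}$ and $\lambda,\omega,\gamma\in\Omega$. *)

theory Defs
  imports Complex_Main
begin

definition bilinear_over ::
    "('k::field \<Rightarrow> 'a::ab_group_add \<Rightarrow> 'a) \<Rightarrow> ('a \<Rightarrow> 'a \<Rightarrow> 'a) \<Rightarrow> bool" where
  "bilinear_over scale f \<longleftrightarrow>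
     (\<forall>x. Vector_Spaces.linear scale scale (\<lambda>y. f x y)) \<and>
     (\<forall>y. Vector_Spaces.linear scale scale (\<lambda>x. f x y))"

text \<open>The semigroup is the type \<open>'w\<close>, with product \<open>*\<close>. The map \<open>prec w\<close> is the operation
  $\prec_w$ and \<open>succ w\<close> is $\succ_w$.\<close>

locale hom_rhizaform_family_algebra = vector_space scale
  for scale :: "'k::field \<Rightarrow> 'a::ab_group_add \<Rightarrow> 'a" +
  fixes prec :: "'w::semigroup_mult \<Rightarrow> 'a \<Rightarrow> 'a \<Rightarrow> 'a"
    and succ :: "'w \<Rightarrow> 'a \<Rightarrow> 'a \<Rightarrow> 'a"
    and \<alpha> :: "'a \<Rightarrow> 'a"
  assumes prec_bilinear: "bilinear_over scale (prec w)"
    and succ_bilinear: "bilinear_over scale (succ w)"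
    and alpha_linear: "Vector_Spaces.linear scale scale \<alpha>"
    and alpha_prec: "\<alpha> (prec w x y) = prec w (\<alpha> x) (\<alpha> y)"
    and alpha_succ: "\<alpha> (succ w x y) = succ w (\<alpha> x) (\<alpha> y)"
    and prec_prec:
      "prec w (prec l x y) (\<alpha> z) = - prec (l * w) (\<alpha> x) (prec w y z + succ l y z)"
    and succ_prec:
      "prec w (succ l x y) (\<alpha> z) = - succ l (\<alpha> x) (prec w y z)"
    and succ_succ:
      "succ (l * w) (prec w x y + succ l x y) (\<alpha> z) = - succ l (\<alpha> x) (succ w y z)"

text \<open>Here \<open>star l w\<close> is the operation $\ast_{l,w}$. The map \<open>\<alpha>\<close> is only required to be linear;
  it need not be multiplicative.\<close>

locale hom_anti_associative_family_algebra = vector_space scale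
  for scale :: "'k::field \<Rightarrow> 'a::ab_group_add \<Rightarrow> 'a" +
  fixes star :: "'w::semigroup_mult \<Rightarrow> 'w \<Rightarrow> 'a \<Rightarrow> 'a \<Rightarrow> 'a"
    and \<alpha> :: "'a \<Rightarrow> 'a"
  assumes star_bilinear: "bilinear_over scale (star l w)"
    and alpha_linear: "Vector_Spaces.linear scale scale \<alpha>"
    and anti_associative:
      "star (l * w) g (star l w x y) (\<alpha> z) = - star l (w * g) (\<alpha> x) (star w g y z)"

end

theory Submission
  imports Defs
begin

text \<open>The three rhizaform axioms split the anti-associativity law into three pieces. Expanding
  both occurrences of $\ast$ in $(x \ast_{l,w} y) \ast_{lw,g} \alpha(z)$ gives
  $(x \prec_w y) \prec_g \alpha(z)$, then $(x \succ_l y) \prec_g \alpha(z)$, and the product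
  $(x \ast_{l,w} y) \succ_{lw} \alpha(z)$. The axioms turn these into
  $-\alpha(x) \prec_{wg} (y \ast_{w,g} z)$, $-\alpha(x) \succ_l (y \prec_g z)$ and
  $-\alpha(x) \succ_l (y \succ_w z)$. The last two recombine, by additivity of $\succ_l$ on the
  right, to $-\alpha(x) \succ_l (y \ast_{w,g} z)$, so the total is
  $-\alpha(x) \ast_{l,wg} (y \ast_{w,g} z)$.\<close>

lemma bilinear_over_add_left:
  assumes "bilinear_over scale f"
  shows "f (x + y) z = f x z + f y z"
  using assms by (metis bilinear_over_def linear_iff_module_hom module_hom.add)

lemma bilinear_over_add_right:
  assumes "bilinear_over scale f"
  shows "f x (y + z) = f x y + f x z"
  using assms by (metis bilinear_over_def linear_iff_module_hom module_hom.add)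

lemma bilinear_over_plus:
  assumes "vector_space scale" "bilinear_over scale f" "bilinear_over scale g"
  shows "bilinear_over scale (\<lambda>x y. f x y + g x y)"
proof -
  interpret vector_space_pair scale scale
    using assms(1) by (simp add: vector_space_pair_def)
  show ?thesis
    using assms(2,3) by (simp add: bilinear_over_def linear_compose_add)
qed

theorem proposition6p3:
  fixes scale :: "'k::field \<Rightarrow> 'a::ab_group_add \<Rightarrow> 'a"
    and prec succ :: "'w::semigroup_mult \<Rightarrow> 'a \<Rightarrow> 'a \<Rightarrow> 'a"
    and \<alpha> :: "'a \<Rightarrow> 'a"
  assumes "hom_rhizaform_family_algebra scale prec succ \<alpha>"
  shows "hom_anti_associative_family_algebra scale (\<lambda>l w x y. prec w x y + succ l x y) \<alpha>"
proof -
  interpret hom_rhizaform_family_algebra scale prec succ \<alpha>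
    by (fact assms)
  show ?thesis
  proof (intro hom_anti_associative_family_algebra.intro
      hom_anti_associative_family_algebra_axioms.intro vector_space_axioms)
    show "bilinear_over scale (\<lambda>x y. prec w x y + succ l x y)" for l w
      using vector_space_axioms prec_bilinear succ_bilinear by (rule bilinear_over_plus)
    show "Vector_Spaces.linear scale scale \<alpha>"
      by (rule alpha_linear)
    show "prec g (prec w x y + succ l x y) (\<alpha> z) + succ (l * w) (prec w x y + succ l x y) (\<alpha> z)
        = - (prec (w * g) (\<alpha> x) (prec g y z + succ w y z)
             + succ l (\<alpha> x) (prec g y z + succ w y z))" for l w g x y z
    proof -
      let ?yz = "prec g y z + succ w y z"
      have "prec g (prec w x y + succ l x y) (\<alpha> z)
          = - prec (w * g) (\<alpha> x) ?yz - succ l (\<alpha> x) (prec g y z)"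
        by (simp add: bilinear_over_add_left[OF prec_bilinear] prec_prec succ_prec)
      moreover have "succ l (\<alpha> x) ?yz = succ l (\<alpha> x) (prec g y z) + succ l (\<alpha> x) (succ w y z)"
        by (rule bilinear_over_add_right[OF succ_bilinear])
      ultimately show ?thesis
        by (simp add: succ_succ)
    qed
  qed
qed

end
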